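(* Let $(\gamma,\nu):I\to\mathbb{R}^2\times S^1$ be a Legendre curve with curvature $(\ell,\beta)$, and write $\gamma(t)=(x(t),z(t))$, $\nu(t)=(a(t),b(t))$. Let $\boldsymbol{x}:I\times[0,2\pi)\to\mathbb{R}^3$, $\boldsymbol{x}(t,\theta)=(x(t),z(t)\cos\theta,z(t)\sin\theta)$, be the surface of revolution of $\gamma$ around the $x$-axis, and put $$\boldsymbol{n}^x(t,\theta)=(-a(t),-b(t)\cos\theta,-b(t)\sin\theta),\qquad \boldsymbol{s}^x(t,\theta)=(0,\sin\theta,-\cos\theta).$$ Then $(\boldsymbol{x},\boldsymbol{n}^x,\boldsymbol{s}^x):I\times[0,2\pi)\to\mathbb{R}^3\times\Delta$ is a framed surface with basic invariants $$\mathcal{G}^x=\begin{pmatrix}0&-\beta(t)\\-z(t)&0\end{pmatrix},\quad \mathcal{F}^x_1=\begin{pmatrix}0&0&\ell(t)\\0&0&0\\-\ell(t)&0&0\end{pmatrix},\quad \mathcal{F}^x_2=\begin{pmatrix}0&b(t)&0\\-b(t)&0&-a(t)\\0&a(t)&0\end{pmatrix}.$$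
   Context: All maps are $C^\infty$; $I\subset\mathbb{R}$ is an interval and $S^1\subset\mathbb R^2$ is the unit circle. A Legendre curve is a smooth map $(\gamma,\nu):I\to\mathbb{R}^2\times S^1$ with $\dot\gamma(t)\cdot\nu(t)=0$ for all $t$. Put $\boldsymbol{\mu}(t)=J(\nu(t))$, where $J$ is anticlockwise rotation by $\pi/2$; the curvature of the Legendre curve is $(\ell,\beta)$ with $\ell=\dot\nu\cdot\boldsymbol{\mu}$, $\beta=\dot\gamma\cdot\boldsymbol{\mu}$. Thus, with $\gamma=(x,z)$, $\nu=(a,b)$: $\dot x=-\beta b$, $\dot z=\beta a$, $\dot a=-\ell b$, $\dot b=\ell a$, $a^2+b^2=1$. $\Delta=\{(\boldsymbol a,\boldsymbol b)\in S^2\times S^2\mid \boldsymbol a\cdot\boldsymbol b=0\}$. A framed surface is a smooth map $(\boldsymbol{X},\boldsymbol{n},\boldsymbol{s}):U\to\mathbb{R}^3\times\Delta$ with $\boldsymbol{X}_u\cdot\boldsymbol{n}=\boldsymbol{X}_v\cdot\boldsymbol{n}=0$ on $U$. With $\boldsymbol{t}=\boldsymbol{n}\times\boldsymbol{s}$, its basic invariants $(\mathcal{G},\mathcal{F}_1,\mathcal{F}_2)$ are the matrices of functions defined by $$\begin{pmatrix}\boldsymbol{X}_u\\\boldsymbol{X}_v\end{pmatrix}=\mathcal{G}\begin{pmatrix}\boldsymbol{s}\\\boldsymbol{t}\end{pmatrix},\quad \begin{pmatrix}\boldsymbol{n}_u\\\boldsymbol{s}_u\\\boldsymbol{t}_u\end{pmatrix}=\mathcal{F}_1\begin{pmatrix}\boldsymbol{n}\\\boldsymbol{s}\\\boldsymbol{t}\end{pmatrix},\quad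 \begin{pmatrix}\boldsymbol{n}_v\\\boldsymbol{s}_v\\\boldsymbol{t}_v\end{pmatrix}=\mathcal{F}_2\begin{pmatrix}\boldsymbol{n}\\\boldsymbol{s}\\\boldsymbol{t}\end{pmatrix}.$$ Here $U=I\times[0,2\pi)$ and $(u,v)=(t,\theta)$. *)

theory Defs
  imports "HOL-Analysis.Analysis"
begin

text \<open>Smoothness. The library has no notion of a C-infinity map between Euclidean spaces.
  On an open set, \<open>Ck_on k W f\<close> asks that all iterated directional derivatives of order up to
  \<open>k\<close> exist and are continuous. On an arbitrary set, such as an interval that contains an endpoint,
  a map is smooth if it extends, near each point of the set, to a smooth map on an open
  neighbourhood.\<close>

primrec Ck_on ::
  "nat \<Rightarrow> 'a::euclidean_space set \<Rightarrow> ('a \<Rightarrow> 'b::euclidean_space) \<Rightarrow> bool" where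
  "Ck_on 0 W f \<longleftrightarrow> continuous_on W f"
| "Ck_on (Suc k) W f \<longleftrightarrow>
     (\<forall>x\<in>W. f differentiable (at x)) \<and>
     (\<forall>h. Ck_on k W (\<lambda>x. frechet_derivative f (at x) h))"

definition smooth_map_on ::
  "'a::euclidean_space set \<Rightarrow> ('a \<Rightarrow> 'b::euclidean_space) \<Rightarrow> bool" where
  "smooth_map_on S f \<longleftrightarrow>
     (\<forall>p\<in>S. \<exists>W g. open W \<and> p \<in> W \<and> (\<forall>k. Ck_on k W g) \<and> (\<forall>x\<in>W \<inter> S. g x = f x))"

definition rot90 :: "real^2 \<Rightarrow> real^2" where
  "rot90 w = vector [- (w $ 2), w $ 1]"

text \<open>Derivatives are taken within the domain, so they are one-sided at a boundary point.\<close>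

definition legendre_curve :: "real set \<Rightarrow> (real \<Rightarrow> real^2) \<Rightarrow> (real \<Rightarrow> real^2) \<Rightarrow> bool" where
  "legendre_curve I \<gamma> \<nu> \<longleftrightarrow>
     smooth_map_on I (\<lambda>t. (\<gamma> t, \<nu> t)) \<and>
     (\<forall>t\<in>I. \<nu> t \<in> sphere 0 1) \<and>
     (\<forall>t\<in>I. vector_derivative \<gamma> (at t within I) \<bullet> \<nu> t = 0)"

definition legendre_curvature ::
  "real set \<Rightarrow> (real \<Rightarrow> real^2) \<Rightarrow> (real \<Rightarrow> real^2) \<Rightarrow>
   (real \<Rightarrow> real) \<Rightarrow> (real \<Rightarrow> real) \<Rightarrow> bool" where
  "legendre_curvature I \<gamma> \<nu> l \<beta> \<longleftrightarrow>
     (\<forall>t\<in>I. l t = vector_derivative \<nu> (at t within I) \<bullet> rot90 (\<nu> t) \<and>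
            \<beta> t = vector_derivative \<gamma> (at t within I) \<bullet> rot90 (\<nu> t))"

definition partial_u ::
  "(real \<times> real) set \<Rightarrow> (real \<times> real \<Rightarrow> real^3) \<Rightarrow> real \<times> real \<Rightarrow> real^3" where
  "partial_u U f p =
     vector_derivative (\<lambda>u. f (u, snd p)) (at (fst p) within {u. (u, snd p) \<in> U})"

definition partial_v ::
  "(real \<times> real) set \<Rightarrow> (real \<times> real \<Rightarrow> real^3) \<Rightarrow> real \<times> real \<Rightarrow> real^3" where
  "partial_v U f p =
     vector_derivative (\<lambda>v. f (fst p, v)) (at (snd p) within {v. (fst p, v) \<in> U})"

definition Delta :: "((real^3) \<times> (real^3)) set" where
  "Delta = {(a, b). a \<in> sphere 0 1 \<and> b \<in> sphere 0 1 \<and> a \<bullet> b = 0}"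

definition framed_surface ::
  "(real \<times> real) set \<Rightarrow> (real \<times> real \<Rightarrow> real^3) \<Rightarrow>
   (real \<times> real \<Rightarrow> real^3) \<Rightarrow> (real \<times> real \<Rightarrow> real^3) \<Rightarrow> bool" where
  "framed_surface U X n s \<longleftrightarrow>
     smooth_map_on U (\<lambda>p. (X p, n p, s p)) \<and>
     (\<forall>p\<in>U. (n p, s p) \<in> Delta) \<and>
     (\<forall>p\<in>U. partial_u U X p \<bullet> n p = 0 \<and> partial_v U X p \<bullet> n p = 0)"

text \<open>A frame is encoded as the matrix whose rows are its vectors. For a framed surface the rows of
  each frame are orthonormal, so these equations determine the three matrices on \<open>U\<close>.\<close>

definition basic_invariants ::
  "(real \<times> real) set \<Rightarrow> (real \<times> real \<Rightarrow> real^3) \<Rightarrow>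
   (real \<times> real \<Rightarrow> real^3) \<Rightarrow> (real \<times> real \<Rightarrow> real^3) \<Rightarrow>
   (real \<times> real \<Rightarrow> real^2^2) \<Rightarrow> (real \<times> real \<Rightarrow> real^3^3) \<Rightarrow>
   (real \<times> real \<Rightarrow> real^3^3) \<Rightarrow> bool" where
  "basic_invariants U X n s G F1 F2 \<longleftrightarrow>
     (let t = (\<lambda>p. cross3 (n p) (s p)) in
      \<forall>p\<in>U.
        (vector [partial_u U X p, partial_v U X p] :: real^3^2) =
          G p ** (vector [s p, t p] :: real^3^2) \<and>
        (vector [partial_u U n p, partial_u U s p, partial_u U t p] :: real^3^3) =
          F1 p ** (vector [n p, s p, t p] :: real^3^3) \<and>
        (vector [partial_v U n p, partial_v U s p, partial_v U t p] :: real^3^3) =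
          F2 p ** (vector [n p, s p, t p] :: real^3^3))"

definition revolution_x :: "(real \<Rightarrow> real^2) \<Rightarrow> real \<times> real \<Rightarrow> real^3" where
  "revolution_x \<gamma> = (\<lambda>(t, \<theta>). vector [\<gamma> t $ 1, \<gamma> t $ 2 * cos \<theta>, \<gamma> t $ 2 * sin \<theta>])"

definition normal_x :: "(real \<Rightarrow> real^2) \<Rightarrow> real \<times> real \<Rightarrow> real^3" where
  "normal_x \<nu> = (\<lambda>(t, \<theta>). vector [- (\<nu> t $ 1), - (\<nu> t $ 2) * cos \<theta>, - (\<nu> t $ 2) * sin \<theta>])"

definition tangent_x :: "real \<times> real \<Rightarrow> real^3" where
  "tangent_x = (\<lambda>(t, \<theta>). vector [0, sin \<theta>, - cos \<theta>])"

end

theory Submission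
  imports Defs
begin

text \<open>The surface, its normal and the third vector of the frame all arise by one construction:
  sending a plane curve \<open>c = (c\<^sub>1, c\<^sub>2)\<close> to
  \<open>(c\<^sub>1(t), c\<^sub>2(t) cos \<theta>, c\<^sub>2(t) sin \<theta>)\<close>, which is \<open>revolution_x c\<close>. The normal is the revolution
  of \<open>- \<nu>\<close>, and the cross product of the normal and \<open>s = tangent_x\<close> is the revolution of \<open>- J \<nu>\<close>.
  The construction is linear in \<open>c\<close>, it commutes with differentiation in \<open>t\<close>, and differentiation
  in \<open>\<theta>\<close> turns the revolution of \<open>c\<close> into \<open>- c\<^sub>2 s\<close>. Finally, the \<open>\<theta>\<close>-derivative of \<open>s\<close> is the
  revolution of the constant curve \<open>(0, 1)\<close>.

  The invariants can therefore be read off in the plane. The frame \<open>(\<nu>, J \<nu>)\<close> is orthonormal, so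
  the hypothesis \<open>\<gamma>' \<bullet> \<nu> = 0\<close> and the identity \<open>\<nu>' \<bullet> \<nu> = 0\<close> (from \<open>|\<nu>| = 1\<close>) give
  \<open>\<gamma>' = \<beta> J \<nu>\<close> and \<open>\<nu>' = l J \<nu>\<close>; revolving these, and the expansion
  \<open>(0, 1) = b \<nu> + a J \<nu>\<close>, produces the entries of the three matrices.

  Smoothness is local. Near a point of \<open>I\<close> the curve extends smoothly to an open set \<open>W\<close>, and the
  revolution of the extension is built from it by sums, products, linear maps and the functions
  \<open>cos\<close> and \<open>sin\<close>, hence is smooth on \<open>W \<times> \<real>\<close>. The corresponding closure properties of \<open>Ck_on\<close>
  follow by induction on the order.\<close>

section \<open>Closure properties of k-fold differentiability\<close>

text \<open>\<open>frechet_derivative f (at x)\<close> is an arbitrary choice where \<open>f\<close> is not differentiable, so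
  computed formulas for it are valid only on \<open>W\<close>. This congruence rule makes such formulas usable
  at the next order; openness is what lets values on \<open>W\<close> determine derivatives on \<open>W\<close>.\<close>

lemma Ck_on_cong:
  assumes "open W" "\<And>x. x \<in> W \<Longrightarrow> f x = g x" "Ck_on k W f"
  shows "Ck_on k W g"
  using assms(2,3)
proof (induction k arbitrary: f g)
  case 0
  then show ?case using continuous_on_eq by auto
next
  case (Suc k)
  have D: "(g has_derivative frechet_derivative f (at x)) (at x)" if "x \<in> W" for x
  proof (rule has_derivative_transform_within_open[OF _ assms(1) that])
    show "(f has_derivative frechet_derivative f (at x)) (at x)"
      using Suc.prems(2) that by (simp add: frechet_derivative_works)
  qed (use Suc.prems(1) in auto)
  have "Ck_on k W (\<lambda>x. frechet_derivative g (at x) h)" for h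
  proof (rule Suc.IH)
    show "Ck_on k W (\<lambda>x. frechet_derivative f (at x) h)"
      using Suc.prems(2) by simp
  qed (use frechet_derivative_at[OF D] in simp)
  then show ?case using D by (auto simp: differentiable_def)
qed

text \<open>The shape of the induction steps below: it suffices to exhibit derivatives on
  \<open>W\<close> and to show that they have one order less.\<close>

lemma Ck_on_SucI:
  assumes "open W" "\<And>x. x \<in> W \<Longrightarrow> (f has_derivative D x) (at x)"
    and "\<And>h. Ck_on k W (\<lambda>x. D x h)"
  shows "Ck_on (Suc k) W f"
proof -
  have "Ck_on k W (\<lambda>x. frechet_derivative f (at x) h)" for h
    by (rule Ck_on_cong[OF assms(1) _ assms(3)]) (use frechet_derivative_at[OF assms(2)] in simp)
  then show ?thesis using assms(2) by (auto simp: differentiable_def)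
qed

lemma Ck_on_Suc_has_derivative:
  "Ck_on (Suc k) W f \<Longrightarrow> x \<in> W \<Longrightarrow> (f has_derivative frechet_derivative f (at x)) (at x)"
  by (simp add: frechet_derivative_works)

lemma Ck_on_Suc_imp:
  "Ck_on (Suc k) W f \<Longrightarrow> Ck_on k W f"
proof (induction k arbitrary: f)
  case 0
  then show ?case
    by (auto intro!: continuous_at_imp_continuous_on differentiable_imp_continuous_within)
next
  case (Suc k)
  then show ?case by (metis Ck_on.simps(2))
qed

lemma Ck_on_subset:
  "Ck_on k W f \<Longrightarrow> V \<subseteq> W \<Longrightarrow> Ck_on k V f"
  by (induction k arbitrary: f) (auto intro: continuous_on_subset)

lemma Ck_on_const:
  assumes "open W"
  shows "Ck_on k W (\<lambda>_. c)"
proof (induction k arbitrary: c)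
  case (Suc k)
  show ?case by (rule Ck_on_SucI[OF assms has_derivative_const Suc])
qed simp

lemma Ck_on_add:
  assumes "open W" "Ck_on k W f" "Ck_on k W g"
  shows "Ck_on k W (\<lambda>x. f x + g x)"
  using assms(2,3)
proof (induction k arbitrary: f g)
  case (Suc k)
  show ?case
    by (rule Ck_on_SucI[OF assms(1)
          has_derivative_add[OF Suc.prems[THEN Ck_on_Suc_has_derivative]]])
       (use Suc in auto)
qed (simp add: continuous_on_add)

lemma Ck_on_linear_image:
  assumes "open W" "bounded_linear L" "Ck_on k W f"
  shows "Ck_on k W (\<lambda>x. L (f x))"
  using assms(3)
proof (induction k arbitrary: f)
  case 0
  then show ?case by (simp add: bounded_linear.continuous_on[OF assms(2)])
next
  case (Suc k)
  show ?case
    by (rule Ck_on_SucI[OF assms(1)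
          bounded_linear.has_derivative[OF assms(2) Ck_on_Suc_has_derivative[OF Suc.prems]]])
       (use Suc in auto)
qed

lemma Ck_on_compose_linear:
  assumes "open W" "bounded_linear L" "Ck_on k W f"
  shows "Ck_on k (L -` W) (\<lambda>x. f (L x))"
  using assms(3)
proof (induction k arbitrary: f)
  case 0
  then show ?case
    by (auto intro!: continuous_on_compose2[of W f] linear_continuous_on[OF assms(2)])
next
  case (Suc k)
  have o: "open (L -` W)"
    using assms(1,2) by (simp add: continuous_open_vimage linear_continuous_at)
  show ?case
  proof (rule Ck_on_SucI[OF o])
    fix x assume "x \<in> L -` W"
    then show "((\<lambda>x. f (L x)) has_derivative
        (\<lambda>h. frechet_derivative f (at (L x)) (L h))) (at x)"
      by (intro has_derivative_compose[OF bounded_linear_imp_has_derivative[OF assms(2)]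
            Ck_on_Suc_has_derivative[OF Suc.prems]]) auto
  next
    show "Ck_on k (L -` W) (\<lambda>x. frechet_derivative f (at (L x)) (L h))" for h
      by (rule Suc.IH) (use Suc.prems in auto)
  qed
qed

lemma Ck_on_scaleR:
  fixes f :: "'a::euclidean_space \<Rightarrow> real" and g :: "'a \<Rightarrow> 'b::euclidean_space"
  assumes "open W" "Ck_on k W f" "Ck_on k W g"
  shows "Ck_on k W (\<lambda>x. f x *\<^sub>R g x)"
  using assms(2,3)
proof (induction k arbitrary: f g)
  case (Suc k)
  note lower = Suc.prems[THEN Ck_on_Suc_imp]
  show ?case
  proof (rule Ck_on_SucI[OF assms(1)
        has_derivative_scaleR[OF Suc.prems[THEN Ck_on_Suc_has_derivative]]])
    fix h
    show "Ck_on k W (\<lambda>x. f x *\<^sub>R frechet_derivative g (at x) h +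
        frechet_derivative f (at x) h *\<^sub>R g x)"
      by (intro Ck_on_add[OF assms(1)] Suc.IH lower) (use Suc.prems in auto)
  qed
qed (simp add: continuous_on_scaleR)

lemma Ck_on_Pair:
  assumes "open W" "Ck_on k W f" "Ck_on k W g"
  shows "Ck_on k W (\<lambda>x. (f x, g x))"
proof -
  have "Ck_on k W (\<lambda>x. (f x, 0) + (0, g x))"
    by (intro Ck_on_add assms Ck_on_linear_image[where f = f] Ck_on_linear_image[where f = g])
       (auto intro!: bounded_linear_intros)
  then show ?thesis by simp
qed

text \<open>Differentiation permutes \<open>sin\<close> and \<open>cos\<close> up to sign, so the induction has to treat both
  at once.\<close>

lemma Ck_on_sin_cos:
  "Ck_on k UNIV (sin :: real \<Rightarrow> real)" "Ck_on k UNIV (cos :: real \<Rightarrow> real)"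
proof (induction k)
  case (Suc k)
  note multiple = Suc[THEN Ck_on_linear_image[OF open_UNIV bounded_linear_mult_right]]
  {
    case 1
    show ?case
      by (rule Ck_on_SucI[where D = "\<lambda>x h. h * cos x", OF open_UNIV _ multiple(2)])
         (auto intro!: derivative_eq_intros)
  next
    case 2
    show ?case
      by (rule Ck_on_SucI[where D = "\<lambda>x h. (- h) * sin x", OF open_UNIV _ multiple(1)])
         (auto intro!: derivative_eq_intros)
  }
qed (auto intro: continuous_on_sin continuous_on_cos)

section \<open>Revolution of a plane curve\<close>

lemma vector_3_eq_axis:
  "(vector [p, q, r] :: real^3) = p *\<^sub>R axis 1 1 + q *\<^sub>R axis 2 1 + r *\<^sub>R axis 3 1"
  by (simp add: vec_eq_iff forall_3 axis_def)

lemma normal_x_eq_revolution: "normal_x \<nu> = revolution_x (\<lambda>t. - \<nu> t)"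
  by (auto simp: normal_x_def revolution_x_def)

lemma cross3_normal_tangent:
  "cross3 (normal_x \<nu> p) (tangent_x p) = revolution_x (\<lambda>t. - rot90 (\<nu> t)) p"
proof -
  have "b * cos \<theta> * cos \<theta> + b * sin \<theta> * sin \<theta> = b" for b \<theta> :: real
    using sin_cos_squared_add[of \<theta>] by algebra
  then show ?thesis
    by (simp add: normal_x_def tangent_x_def revolution_x_def rot90_def cross3_def
        split: prod.split)
qed

lemma Ck_on_revolution:
  assumes "open W" "Ck_on k W c"
  shows "Ck_on k (W \<times> UNIV) (revolution_x c)"
proof -
  have o: "open (W \<times> (UNIV :: real set))"
    using assms(1) by (simp add: open_Times)
  have c: "Ck_on k (W \<times> UNIV) (\<lambda>p :: real \<times> real. c (fst p) $ i)" for i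
    using Ck_on_compose_linear[OF assms(1) bounded_linear_fst assms(2)]
    by (intro Ck_on_linear_image[OF o bounded_linear_vec_nth]) (simp add: vimage_fst)
  have trig: "Ck_on k (W \<times> UNIV) (\<lambda>p :: real \<times> real. sin (snd p))"
    "Ck_on k (W \<times> UNIV) (\<lambda>p :: real \<times> real. cos (snd p))"
    using Ck_on_sin_cos[THEN Ck_on_compose_linear[OF open_UNIV bounded_linear_snd]]
    by (auto intro: Ck_on_subset)
  have eq: "revolution_x c = (\<lambda>p. c (fst p) $ 1 *\<^sub>R axis 1 1 +
      c (fst p) $ 2 *\<^sub>R cos (snd p) *\<^sub>R axis 2 1 + c (fst p) $ 2 *\<^sub>R sin (snd p) *\<^sub>R axis 3 1)"
    by (auto simp: revolution_x_def vector_3_eq_axis)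
  show ?thesis
    unfolding eq by (intro Ck_on_add Ck_on_scaleR Ck_on_const o c trig)
qed

lemma Ck_on_tangent_x: "Ck_on k UNIV tangent_x"
proof -
  note trig = Ck_on_sin_cos[THEN Ck_on_compose_linear[OF open_UNIV bounded_linear_snd],
      unfolded vimage_UNIV]
  have eq: "tangent_x = (\<lambda>p :: real \<times> real. sin (snd p) *\<^sub>R axis 2 1 + cos (snd p) *\<^sub>R (- axis 3 1))"
    by (auto simp: tangent_x_def vector_3_eq_axis)
  show ?thesis
    unfolding eq by (intro Ck_on_add[OF open_UNIV] Ck_on_scaleR[OF open_UNIV]
        Ck_on_const[OF open_UNIV] trig)
qed

text \<open>In the next lemmas the nontriviality of the within-filter makes \<open>vector_derivative\<close> unique.
  This matters at endpoints, in particular at \<open>\<theta> = 0\<close>, where the derivative is one-sided.\<close>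

lemma partial_u_revolution:
  assumes "(c has_vector_derivative c' t) (at t within I)" "at t within I \<noteq> bot" "\<theta> \<in> T"
  shows "partial_u (I \<times> T) (revolution_x c) (t, \<theta>) = revolution_x c' (t, \<theta>)"
proof -
  have "((\<lambda>u. c u $ i) has_vector_derivative c' t $ i) (at t within I)" for i
    using bounded_linear.has_vector_derivative[OF bounded_linear_vec_nth assms(1)] .
  then have "((\<lambda>u. revolution_x c (u, \<theta>)) has_vector_derivative revolution_x c' (t, \<theta>))
      (at t within I)"
    by (auto simp: revolution_x_def vector_3_eq_axis
        has_real_derivative_iff_has_vector_derivative[symmetric] intro!: derivative_eq_intros)
  then show ?thesis
    using vector_derivative_within[OF assms(2)] assms(3) by (simp add: partial_u_def)
qed

lemma partial_v_revolution:
  assumes "t \<in> I" "at \<theta> within T \<noteq> bot"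
  shows "partial_v (I \<times> T) (revolution_x c) (t, \<theta>) = - (c t $ 2) *\<^sub>R tangent_x (t, \<theta>)"
proof -
  have "((\<lambda>v. revolution_x c (t, v)) has_vector_derivative - (c t $ 2) *\<^sub>R tangent_x (t, \<theta>))
      (at \<theta> within T)"
    by (auto simp: revolution_x_def tangent_x_def vector_3_eq_axis algebra_simps
        intro!: derivative_eq_intros)
  then show ?thesis
    using vector_derivative_within[OF assms(2)] assms(1) by (simp add: partial_v_def)
qed

lemma partial_u_tangent:
  "at t within I \<noteq> bot \<Longrightarrow> \<theta> \<in> T \<Longrightarrow> partial_u (I \<times> T) tangent_x (t, \<theta>) = 0"
  by (auto simp: partial_u_def tangent_x_def intro!: vector_derivative_within)

lemma partial_v_tangent:
  assumes "t \<in> I" "at \<theta> within T \<noteq> bot"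
  shows "partial_v (I \<times> T) tangent_x (t, \<theta>) = revolution_x (\<lambda>_. vector [0, 1]) (t, \<theta>)"
proof -
  have "((\<lambda>v. tangent_x (t, v)) has_vector_derivative revolution_x (\<lambda>_. vector [0, 1]) (t, \<theta>))
      (at \<theta> within T)"
    by (auto simp: revolution_x_def tangent_x_def vector_3_eq_axis intro!: derivative_eq_intros)
  then show ?thesis
    using vector_derivative_within[OF assms(2)] assms(1) by (simp add: partial_v_def)
qed

section \<open>The Frenet equations of a Legendre curve\<close>

lemma interval_at_within_neq_bot:
  fixes I :: "real set"
  assumes "is_interval I" "interior I \<noteq> {}" "t \<in> I"
  shows "at t within I \<noteq> bot"
proof -
  have "\<not> I \<subseteq> {t}"
    using assms(2) interior_mono[of I "{t}"] by auto
  then have "t islimpt I"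
    using assms(1,3) by (intro connected_imp_perfect) (auto simp: is_interval_connected)
  then show ?thesis by (simp add: trivial_limit_within)
qed

lemma smooth_map_on_imp_has_vector_derivative:
  fixes f :: "real \<Rightarrow> 'b::euclidean_space"
  assumes "smooth_map_on I f" "t \<in> I"
  shows "(f has_vector_derivative vector_derivative f (at t within I)) (at t within I)"
proof -
  obtain W g where W: "open W" "t \<in> W" "Ck_on (Suc 0) W g" "\<forall>x\<in>W \<inter> I. g x = f x"
    using assms unfolding smooth_map_on_def by blast
  then have "g differentiable at t within I"
    by (auto intro: differentiable_at_withinI)
  moreover obtain d where "0 < d" "ball t d \<subseteq> W"
    using W(1,2) by (meson openE)
  ultimately have "f differentiable at t within I"
    using W(4) assms(2)
    by (elim differentiable_transform_within) (auto simp: subset_iff dist_commute)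
  then show ?thesis by (simp add: vector_derivative_works)
qed

text \<open>This expansion converts scalar data, namely a vanishing normal component and the curvature
  as the remaining component, into equations between vectors.\<close>

lemma orthonormal_expansion_rot90:
  assumes "norm \<nu> = 1"
  shows "w = (w \<bullet> \<nu>) *\<^sub>R \<nu> + (w \<bullet> rot90 \<nu>) *\<^sub>R rot90 \<nu>"
proof -
  have "\<nu> $ 1 * \<nu> $ 1 + \<nu> $ 2 * \<nu> $ 2 = 1"
    using assms by (simp add: norm_eq_1 inner_vec_def sum_2)
  then show ?thesis
    by (simp add: vec_eq_iff forall_2 inner_vec_def sum_2 rot90_def) algebra
qed

text \<open>\<open>\<gamma>'\<close> has no \<open>\<nu>\<close>-component by hypothesis, and \<open>\<nu>'\<close> has none because \<open>\<nu> \<bullet> \<nu>\<close> is constant;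
  the components along \<open>rot90 \<nu>\<close> are the curvature by definition.\<close>

lemma legendre_curve_frenet:
  assumes I: "is_interval I" "interior I \<noteq> {}"
    and leg: "legendre_curve I \<gamma> \<nu>" and curv: "legendre_curvature I \<gamma> \<nu> l \<beta>" and t: "t \<in> I"
  shows "(\<gamma> has_vector_derivative \<beta> t *\<^sub>R rot90 (\<nu> t)) (at t within I)"
    and "(\<nu> has_vector_derivative l t *\<^sub>R rot90 (\<nu> t)) (at t within I)"
proof -
  note nt = interval_at_within_neq_bot[OF I t]
  have unit: "norm (\<nu> u) = 1" if "u \<in> I" for u
    using leg that by (auto simp: legendre_curve_def)
  have pair: "((\<lambda>u. (\<gamma> u, \<nu> u)) has_vector_derivative
      vector_derivative (\<lambda>u. (\<gamma> u, \<nu> u)) (at t within I)) (at t within I)"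
    using leg t by (intro smooth_map_on_imp_has_vector_derivative) (auto simp: legendre_curve_def)
  have g: "(\<gamma> has_vector_derivative vector_derivative \<gamma> (at t within I)) (at t within I)"
    using bounded_linear.has_vector_derivative[OF bounded_linear_fst pair]
    by (auto simp: vector_derivative_works[symmetric] intro: differentiableI_vector)
  have n: "(\<nu> has_vector_derivative vector_derivative \<nu> (at t within I)) (at t within I)"
    using bounded_linear.has_vector_derivative[OF bounded_linear_snd pair]
    by (auto simp: vector_derivative_works[symmetric] intro: differentiableI_vector)
  have "vector_derivative \<gamma> (at t within I) = \<beta> t *\<^sub>R rot90 (\<nu> t)"
    using orthonormal_expansion_rot90[OF unit[OF t], of "vector_derivative \<gamma> (at t within I)"]
      leg curv t
    by (simp add: legendre_curve_def legendre_curvature_def)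
  then show "(\<gamma> has_vector_derivative \<beta> t *\<^sub>R rot90 (\<nu> t)) (at t within I)"
    using g by simp
  have "((\<lambda>u. \<nu> u \<bullet> \<nu> u) has_vector_derivative
      2 * (vector_derivative \<nu> (at t within I) \<bullet> \<nu> t)) (at t within I)"
    using bounded_bilinear.has_vector_derivative[OF bounded_bilinear_inner n n]
    by (simp add: inner_commute)
  moreover have "((\<lambda>u. \<nu> u \<bullet> \<nu> u) has_vector_derivative 0) (at t within I)"
    by (rule has_vector_derivative_transform[OF t _ has_vector_derivative_const[of 1]])
       (use unit in \<open>simp add: norm_eq_1\<close>)
  ultimately have "2 * (vector_derivative \<nu> (at t within I) \<bullet> \<nu> t) = 0"
    by (rule vector_derivative_unique_within[OF nt])
  then have "vector_derivative \<nu> (at t within I) \<bullet> \<nu> t = 0"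
    by simp
  then have "vector_derivative \<nu> (at t within I) = l t *\<^sub>R rot90 (\<nu> t)"
    using orthonormal_expansion_rot90[OF unit[OF t], of "vector_derivative \<nu> (at t within I)"]
      curv t
    by (simp add: legendre_curvature_def)
  then show "(\<nu> has_vector_derivative l t *\<^sub>R rot90 (\<nu> t)) (at t within I)"
    using n by simp
qed

section \<open>The surface of revolution as a framed surface\<close>

lemma smooth_map_on_revolution_frame:
  assumes "smooth_map_on I (\<lambda>t. (\<gamma> t, \<nu> t))"
  shows "smooth_map_on (I \<times> T) (\<lambda>p. (revolution_x \<gamma> p, normal_x \<nu> p, tangent_x p))"
  unfolding smooth_map_on_def
proof
  fix p assume "p \<in> I \<times> T"
  then obtain W g where W: "open W" "fst p \<in> W" "\<And>k. Ck_on k W g"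
    and g: "\<forall>t\<in>W \<inter> I. g t = (\<gamma> t, \<nu> t)"
    using assms unfolding smooth_map_on_def by (metis mem_Times_iff)
  let ?G = "\<lambda>p. (revolution_x (\<lambda>t. fst (g t)) p, revolution_x (\<lambda>t. - snd (g t)) p, tangent_x p)"
  have "Ck_on k (W \<times> UNIV) ?G" for k
    by (intro Ck_on_Pair Ck_on_revolution open_Times open_UNIV
          Ck_on_subset[OF Ck_on_tangent_x subset_UNIV]
          Ck_on_linear_image[OF W(1) bounded_linear_fst]
          Ck_on_linear_image[OF W(1) bounded_linear_minus[OF bounded_linear_snd]] W)
  moreover have "\<forall>q\<in>(W \<times> UNIV) \<inter> (I \<times> T).
      ?G q = (revolution_x \<gamma> q, normal_x \<nu> q, tangent_x q)"
    using g by (auto simp: normal_x_eq_revolution revolution_x_def)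
  ultimately show "\<exists>V G. open V \<and> p \<in> V \<and> (\<forall>k. Ck_on k V G) \<and>
      (\<forall>q\<in>V \<inter> (I \<times> T). G q = (revolution_x \<gamma> q, normal_x \<nu> q, tangent_x q))"
    using W(1,2) by (intro exI[of _ "W \<times> UNIV"] exI[of _ ?G])
      (auto simp: open_Times mem_Times_iff)
qed

lemma normal_tangent_in_Delta:
  assumes "norm (\<nu> t) = 1"
  shows "(normal_x \<nu> (t, \<theta>), tangent_x (t, \<theta>)) \<in> Delta"
proof -
  have "\<nu> t $ 1 * \<nu> t $ 1 + \<nu> t $ 2 * \<nu> t $ 2 = 1"
    using assms by (simp add: norm_eq_1 inner_vec_def sum_2)
  moreover have "sin \<theta> * sin \<theta> + cos \<theta> * cos \<theta> = 1"
    using sin_cos_squared_add[of \<theta>] by (simp add: power2_eq_square)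
  ultimately show ?thesis
    by (simp add: Delta_def normal_x_def tangent_x_def norm_eq_1 inner_vec_def sum_3) algebra
qed

theorem proposition3p1:
  fixes I :: "real set" and \<gamma> \<nu> :: "real \<Rightarrow> real^2" and l \<beta> :: "real \<Rightarrow> real"
  assumes "is_interval I" and "interior I \<noteq> {}"
    and "legendre_curve I \<gamma> \<nu>"
    and "legendre_curvature I \<gamma> \<nu> l \<beta>"
  shows "framed_surface (I \<times> {0..<2 * pi}) (revolution_x \<gamma>) (normal_x \<nu>) tangent_x \<and>
    basic_invariants (I \<times> {0..<2 * pi}) (revolution_x \<gamma>) (normal_x \<nu>) tangent_x
      (\<lambda>(t, \<theta>). vector [vector [0, - \<beta> t],
                        vector [- (\<gamma> t $ 2), 0]])
      (\<lambda>(t, \<theta>). vector [vector [0, 0, l t],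
                        vector [0, 0, 0],
                        vector [- l t, 0, 0]])
      (\<lambda>(t, \<theta>). vector [vector [0, \<nu> t $ 2, 0],
                        vector [- (\<nu> t $ 2), 0, - (\<nu> t $ 1)],
                        vector [0, \<nu> t $ 1, 0]])"
proof -
  let ?T = "{0..<2 * pi}"
  let ?U = "I \<times> ?T"
  let ?X = "revolution_x \<gamma>" and ?n = "normal_x \<nu>" and ?s = tangent_x
  let ?t = "\<lambda>p. cross3 (normal_x \<nu> p) (tangent_x p)"
  have unit: "norm (\<nu> t) = 1" if "t \<in> I" for t
    using assms(3) that by (auto simp: legendre_curve_def)
  have rot90_linear: "bounded_linear rot90"
    by (intro linear_conv_bounded_linear[THEN iffD1] linearI)
       (auto simp: rot90_def vec_eq_iff forall_2)
  have partials:
    "partial_u ?U ?X p = - \<beta> (fst p) *\<^sub>R ?t p"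
    "partial_u ?U ?n p = l (fst p) *\<^sub>R ?t p"
    "partial_u ?U ?s p = 0"
    "partial_u ?U ?t p = - l (fst p) *\<^sub>R ?n p"
    "partial_v ?U ?X p = - (\<gamma> (fst p) $ 2) *\<^sub>R ?s p"
    "partial_v ?U ?n p = (\<nu> (fst p) $ 2) *\<^sub>R ?s p"
    "partial_v ?U ?s p = - (\<nu> (fst p) $ 2) *\<^sub>R ?n p - (\<nu> (fst p) $ 1) *\<^sub>R ?t p"
    "partial_v ?U ?t p = (\<nu> (fst p) $ 1) *\<^sub>R ?s p"
    if pU: "p \<in> ?U" for p
  proof -
    obtain t \<theta> where p: "p = (t, \<theta>)" and t: "t \<in> I" and \<theta>: "\<theta> \<in> ?T"
      using pU by (metis SigmaE)
    note nt = interval_at_within_neq_bot[OF assms(1,2) t]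
    have n\<theta>: "at \<theta> within ?T \<noteq> bot"
      by (rule interval_at_within_neq_bot) (use \<theta> in \<open>auto simp: is_interval_co\<close>)
    note \<gamma>' = legendre_curve_frenet(1)[OF assms t] and \<nu>' = legendre_curve_frenet(2)[OF assms t]
    note u = partial_u_revolution[OF _ nt \<theta>] and v = partial_v_revolution[OF t n\<theta>]
    show "partial_u ?U ?X p = - \<beta> (fst p) *\<^sub>R ?t p"
      unfolding p cross3_normal_tangent
      by (subst u[where c' = "\<lambda>t. \<beta> t *\<^sub>R rot90 (\<nu> t)", OF \<gamma>'])
         (simp add: revolution_x_def vec_eq_iff forall_3)
    show "partial_u ?U ?n p = l (fst p) *\<^sub>R ?t p"
      unfolding p cross3_normal_tangent unfolding normal_x_eq_revolution
      by (subst u[where c' = "\<lambda>t. - (l t *\<^sub>R rot90 (\<nu> t))", OF has_vector_derivative_minus[OF \<nu>']])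
         (simp add: revolution_x_def vec_eq_iff forall_3)
    show "partial_u ?U ?s p = 0"
      unfolding p by (rule partial_u_tangent[OF nt \<theta>])
    \<comment> \<open>Differentiating \<open>- J \<nu>\<close> applies \<open>J\<close> twice, and \<open>J\<close> squared is \<open>- 1\<close>.\<close>
    show "partial_u ?U ?t p = - l (fst p) *\<^sub>R ?n p"
      unfolding p cross3_normal_tangent unfolding normal_x_eq_revolution
      by (subst u[where c' = "\<lambda>t. - rot90 (l t *\<^sub>R rot90 (\<nu> t))",
            OF has_vector_derivative_minus[OF
              bounded_linear.has_vector_derivative[OF rot90_linear \<nu>']]])
         (simp add: revolution_x_def rot90_def vec_eq_iff forall_3)
    show "partial_v ?U ?X p = - (\<gamma> (fst p) $ 2) *\<^sub>R ?s p"
      unfolding p v by simp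
    show "partial_v ?U ?n p = (\<nu> (fst p) $ 2) *\<^sub>R ?s p"
      unfolding p normal_x_eq_revolution v by simp
    show "partial_v ?U ?t p = (\<nu> (fst p) $ 1) *\<^sub>R ?s p"
      unfolding p cross3_normal_tangent v by (simp add: rot90_def)
    have e2: "(vector [0, 1] :: real^2) = (\<nu> t $ 2) *\<^sub>R \<nu> t + (\<nu> t $ 1) *\<^sub>R rot90 (\<nu> t)"
      using orthonormal_expansion_rot90[OF unit[OF t], of "vector [0, 1]"]
      by (simp add: inner_vec_def sum_2 rot90_def)
    have "revolution_x (\<lambda>_. vector [0, 1]) (t, \<theta>) =
        - (\<nu> t $ 2) *\<^sub>R ?n (t, \<theta>) - (\<nu> t $ 1) *\<^sub>R ?t (t, \<theta>)"
      unfolding cross3_normal_tangent unfolding normal_x_eq_revolution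
      by (subst e2) (simp add: revolution_x_def vec_eq_iff forall_3 algebra_simps)
    then show "partial_v ?U ?s p = - (\<nu> (fst p) $ 2) *\<^sub>R ?n p - (\<nu> (fst p) $ 1) *\<^sub>R ?t p"
      unfolding p partial_v_tangent[OF t n\<theta>] by simp
  qed
  have frame: "(?n p, ?s p) \<in> Delta" if "p \<in> ?U" for p
    using that normal_tangent_in_Delta unit by auto
  have "framed_surface ?U ?X ?n ?s"
    unfolding framed_surface_def
    using assms(3) frame partials(1,5)
    by (auto simp: legendre_curve_def smooth_map_on_revolution_frame Delta_def dot_cross_self
        inner_commute)
  moreover have "basic_invariants ?U ?X ?n ?s
      (\<lambda>(t, \<theta>). vector [vector [0, - \<beta> t], vector [- (\<gamma> t $ 2), 0]])
      (\<lambda>(t, \<theta>). vector [vector [0, 0, l t], vector [0, 0, 0], vector [- l t, 0, 0]])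
      (\<lambda>(t, \<theta>). vector [vector [0, \<nu> t $ 2, 0], vector [- (\<nu> t $ 2), 0, - (\<nu> t $ 1)],
                        vector [0, \<nu> t $ 1, 0]])"
    unfolding basic_invariants_def Let_def
    by (simp add: partials split_beta vec_eq_iff[of "_ :: real^3^_"] forall_2 forall_3)
       (simp add: vec_eq_iff matrix_matrix_mult_def sum_2 sum_3)
  ultimately show ?thesis by blast
qed

end
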